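(* Let $\gamma:\mathbb{R}^d\to\mathbb{R}$ be a gauge, and let $x,y\in\mathbb{R}^d$, $\varepsilon\geq 0$, and $\alpha\in\mathbb{R}$. Write $\operatorname{lin}\{x\}=\{\lambda x : \lambda\in\mathbb{R}\}$. The following statements are equivalent: (a) The point $\alpha x+y$ is an $\varepsilon$-best approximation of $0$ in $y+\operatorname{lin}\{x\}$. (b) The point $\alpha x$ is an $\varepsilon$-best approximation of $-y$ in $\operatorname{lin}\{x\}$. (c) We have $(\alpha x+y)\perp_B^\varepsilon x$. (d) There exists $x^\ast\in\mathbb{R}^d$ such that $\gamma^\circ(x^\ast)=1$, $\langle x^\ast\,|\,x\rangle=0$ and $\langle x^\ast\,|\,y\rangle\geq\gamma(\alpha x+y)-\varepsilon$. Moreover, the set of numbers $\alpha\in\mathbb{R}$ such that $(\alpha x+y)\perp_B^\varepsilon x$ is a compact interval provided $x\neq 0$.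
   Context: A gauge is a function $\gamma:\mathbb{R}^d\to\mathbb{R}$ such that $\gamma(x)\geq 0$ for all $x$, $\gamma(x)=0$ implies $x=0$, $\gamma(\lambda x)=\lambda\gamma(x)$ for all $\lambda>0$, and $\gamma(x+y)\leq\gamma(x)+\gamma(y)$ (it need not be symmetric). $\langle\cdot\,|\,\cdot\rangle$ is the Euclidean inner product. The polar function is $\gamma^\circ(x^\ast)=\inf\{\lambda>0 : \langle x^\ast\,|\,x\rangle\leq\lambda\gamma(x)\text{ for all }x\in\mathbb{R}^d\}$. For $\varepsilon\ge 0$, $x\perp_B^\varepsilon y$ ($\varepsilon$-Birkhoff orthogonality) means $\gamma(x)\leq\gamma(x+\lambda y)+\varepsilon$ for all $\lambda\in\mathbb{R}$. For a non-empty closed convex set $K\subseteq\mathbb{R}^d$, a point $p\in K$ is an $\varepsilon$-best approximation of $q\in\mathbb{R}^d$ in $K$ if $\gamma(p-q)\leq\gamma(z-q)+\varepsilon$ for all $z\in K$.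
   Formalization: (c)⇒(d) is stated only for d ≥ 2 or x = 0, and d ≥ 1 throughout: if d = 1 and x ≠ 0, ⟨x*|x⟩ = 0 forces x* = 0 with γ°(x* ) = 0, so (d) never holds, while (a)–(c) hold when αx+y = 0; for d = 0, (d) fails likewise. *)

theory Defs
  imports "HOL-Analysis.Analysis"
begin

(* Named gauge_fun because HOL-Analysis already uses "gauge" for the gauges of
   Henstock-Kurzweil integration.  No symmetry is required. *)
definition gauge_fun :: "(real^'n \<Rightarrow> real) \<Rightarrow> bool" where
  "gauge_fun \<gamma> \<longleftrightarrow>
     (\<forall>x. 0 \<le> \<gamma> x) \<and>
     (\<forall>x. \<gamma> x = 0 \<longrightarrow> x = 0) \<and>
     (\<forall>x. \<forall>l>0. \<gamma> (l *\<^sub>R x) = l * \<gamma> x) \<and>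
     (\<forall>x y. \<gamma> (x + y) \<le> \<gamma> x + \<gamma> y)"

(* For a gauge the set below is non-empty and bounded below by 0, so the real
   infimum is the genuine one. *)
definition polar_fun :: "(real^'n \<Rightarrow> real) \<Rightarrow> real^'n \<Rightarrow> real" where
  "polar_fun \<gamma> xs = Inf {l. 0 < l \<and> (\<forall>x. xs \<bullet> x \<le> l * \<gamma> x)}"

definition eps_birkhoff ::
    "(real^'n \<Rightarrow> real) \<Rightarrow> real \<Rightarrow> real^'n \<Rightarrow> real^'n \<Rightarrow> bool" where
  "eps_birkhoff \<gamma> \<epsilon> x y \<longleftrightarrow> (\<forall>l. \<gamma> x \<le> \<gamma> (x + l *\<^sub>R y) + \<epsilon>)"

(* p is an \<epsilon>-best approximation of q in K; meant for non-empty closed convex K.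
   The order of the difference p - q matters, as \<gamma> need not be symmetric. *)
definition eps_best_approx ::
    "(real^'n \<Rightarrow> real) \<Rightarrow> real \<Rightarrow> (real^'n) set \<Rightarrow> real^'n \<Rightarrow> real^'n \<Rightarrow> bool" where
  "eps_best_approx \<gamma> \<epsilon> K q p \<longleftrightarrow>
     p \<in> K \<and> (\<forall>z\<in>K. \<gamma> (p - q) \<le> \<gamma> (z - q) + \<epsilon>)"

end

theory Submission
  imports Defs
begin

text \<open>All four statements concern the convex function \<open>f \<beta> = \<gamma> (\<beta> *\<^sub>R x + y)\<close>. For (c) implies (d),
  the level \<open>t = f \<alpha> - \<epsilon>\<close> is a lower bound of \<open>\<gamma>\<close> on the line \<open>y + lin {x}\<close>. If \<open>t > 0\<close>, separating
  this line from the open convex set \<open>{\<gamma> < t}\<close> gives a functional that vanishes at \<open>x\<close>;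
  normalising its polar value to 1 gives (d). If \<open>t \<le> 0\<close>, any functional vanishing at \<open>x\<close> will
  do, up to sign. The final claim holds because \<open>f\<close> is continuous, convex and coercive.\<close>

section \<open>Sublevel sets of convex functions\<close>

lemma convex_strict_sublevel:
  fixes f :: "'a::real_vector \<Rightarrow> real"
  assumes "convex_on UNIV f"
  shows "convex {z. f z < r}"
proof (rule convexI, unfold mem_Collect_eq)
  fix u v :: 'a and a b :: real
  assume uv: "f u < r" "f v < r" and ab: "0 \<le> a" "0 \<le> b" "a + b = 1"
  have "f (a *\<^sub>R u + b *\<^sub>R v) \<le> a * f u + b * f v"
    using assms ab by (simp add: convex_on_def)
  also have "\<dots> < r" using uv ab by (rule convex_bound_lt)
  finally show "f (a *\<^sub>R u + b *\<^sub>R v) < r" .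
qed

lemma convex_sublevel:
  fixes f :: "'a::real_vector \<Rightarrow> real"
  assumes "convex_on UNIV f"
  shows "convex {z. f z \<le> r}"
proof -
  have "{z. f z \<le> r} = (\<Inter>s\<in>{r<..}. {z. f z < s})"
    by (auto intro: dense_ge)
  then show ?thesis using convex_strict_sublevel[OF assms] by (simp add: convex_INT)
qed

section \<open>Basic properties of gauges\<close>

lemma gauge_fun_zero:
  assumes "gauge_fun \<gamma>"
  shows "\<gamma> 0 = 0"
proof -
  have "\<forall>l>0. \<gamma> (l *\<^sub>R 0) = l * \<gamma> 0"
    using assms unfolding gauge_fun_def by blast
  \<comment> \<open>Homogeneity covers only positive factors, so the factor 0 is out of reach; the
    factor 2 gives \<open>\<gamma> 0 = 2 * \<gamma> 0\<close>.\<close>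
  from this[rule_format, of 2] show ?thesis by simp
qed

lemma gauge_fun_pos_iff:
  assumes "gauge_fun \<gamma>"
  shows "0 < \<gamma> z \<longleftrightarrow> z \<noteq> 0"
proof -
  have "0 \<le> \<gamma> z" and "\<gamma> z = 0 \<Longrightarrow> z = 0"
    using assms unfolding gauge_fun_def by blast+
  then show ?thesis
    using gauge_fun_zero[OF assms] by (auto simp: less_le)
qed

lemma gauge_fun_scale:
  assumes "gauge_fun \<gamma>" and "0 \<le> l"
  shows "\<gamma> (l *\<^sub>R z) = l * \<gamma> z"
proof (cases "l = 0")
  case True
  then show ?thesis
    using gauge_fun_zero[OF assms(1)] by simp
next
  case False
  then show ?thesis using assms by (simp add: gauge_fun_def)
qed

lemma convex_on_gauge_fun:
  fixes \<gamma> :: "real^'n \<Rightarrow> real"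
  assumes "gauge_fun \<gamma>"
  shows "convex_on UNIV \<gamma>"
proof (rule convex_onI)
  fix t :: real and u v :: "real^'n"
  assume "0 < t" "t < 1"
  moreover have "\<gamma> ((1 - t) *\<^sub>R u + t *\<^sub>R v) \<le> \<gamma> ((1 - t) *\<^sub>R u) + \<gamma> (t *\<^sub>R v)"
    using assms unfolding gauge_fun_def by blast
  ultimately show "\<gamma> ((1 - t) *\<^sub>R u + t *\<^sub>R v) \<le> (1 - t) * \<gamma> u + t * \<gamma> v"
    by (simp add: gauge_fun_scale[OF assms])
qed simp

lemma continuous_on_gauge_fun:
  assumes "gauge_fun \<gamma>"
  shows "continuous_on UNIV \<gamma>"
  using convex_on_continuous[OF open_UNIV convex_on_gauge_fun[OF assms]] .

text \<open>By continuity \<open>\<gamma>\<close> attains its minimum on the compact unit sphere.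
  That minimum is positive and serves as \<open>c\<close>; homogeneity carries the bound to all
  vectors. This makes polar values finite and yields coercivity along lines.\<close>

lemma gauge_fun_lower_bound:
  fixes \<gamma> :: "real^'n \<Rightarrow> real"
  assumes "gauge_fun \<gamma>"
  obtains c where "0 < c" "\<And>z. c * norm z \<le> \<gamma> z"
proof -
  have "\<exists>u\<in>sphere (0::real^'n) 1. \<forall>z\<in>sphere 0 1. \<gamma> u \<le> \<gamma> z"
    by (intro continuous_attains_inf compact_sphere
        continuous_on_subset[OF continuous_on_gauge_fun[OF assms]]) auto
  then obtain u where u: "norm u = 1" "\<And>z. norm z = 1 \<Longrightarrow> \<gamma> u \<le> \<gamma> z" by auto
  show ?thesis
  proof (rule that)
    show "0 < \<gamma> u" using u(1) gauge_fun_pos_iff[OF assms, of u] by auto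
    show "\<gamma> u * norm z \<le> \<gamma> z" for z
    proof (cases "z = 0")
      case True
      then show ?thesis using assms by (simp add: gauge_fun_def)
    next
      case False
      have "\<gamma> u \<le> \<gamma> (inverse (norm z) *\<^sub>R z)" using False by (intro u(2)) simp
      also have "\<dots> = inverse (norm z) * \<gamma> z" by (simp add: gauge_fun_scale[OF assms])
      finally show ?thesis using False by (simp add: field_simps)
    qed
  qed
qed

section \<open>The polar function and its normalisation\<close>

lemma inner_le_polar_fun:
  assumes "gauge_fun \<gamma>"
  shows "a \<bullet> z \<le> polar_fun \<gamma> a * \<gamma> z"
proof (cases "z = 0")
  case True
  then show ?thesis using gauge_fun_scale[OF assms, of 0 z] by simp
next
  case False
  then have pos: "0 < \<gamma> z" by (simp add: gauge_fun_pos_iff[OF assms])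
  obtain c where c: "0 < c" "\<And>w. c * norm w \<le> \<gamma> w"
    using gauge_fun_lower_bound[OF assms] by blast
  \<comment> \<open>This witness shows that the set under the infimum is non-empty, as
    \<open>cInf_greatest\<close> requires. The summand 1 keeps it positive even for
    \<open>a = 0\<close>.\<close>
  have "a \<bullet> w \<le> (norm a + 1) / c * \<gamma> w" for w
  proof -
    have "a \<bullet> w \<le> (norm a + 1) * norm w"
      using norm_cauchy_schwarz[of a w] by (simp add: distrib_right add_increasing2)
    also have "\<dots> \<le> (norm a + 1) * (\<gamma> w / c)"
      using c by (intro mult_left_mono) (simp_all add: field_simps)
    finally show ?thesis by simp
  qed
  moreover have "0 < (norm a + 1) / c" using c(1) by (simp add: add_nonneg_pos)
  ultimately have "a \<bullet> z / \<gamma> z \<le> polar_fun \<gamma> a"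
    unfolding polar_fun_def using pos
    by (intro cInf_greatest) (auto simp: pos_divide_le_eq)
  then show ?thesis using pos by (simp add: pos_divide_le_eq)
qed

lemma polar_fun_le:
  assumes "0 < l" and "\<And>z. a \<bullet> z \<le> l * \<gamma> z"
  shows "polar_fun \<gamma> a \<le> l"
  unfolding polar_fun_def using assms by (intro cInf_lower bdd_belowI[of _ 0]) auto

lemma polar_fun_pos:
  assumes "gauge_fun \<gamma>" and "a \<noteq> 0"
  shows "0 < polar_fun \<gamma> a"
proof -
  have "0 < polar_fun \<gamma> a * \<gamma> a"
    using inner_le_polar_fun[OF assms(1), of a a] assms(2)
    by (meson inner_gt_zero_iff less_le_trans)
  moreover have "0 < \<gamma> a" using assms by (simp add: gauge_fun_pos_iff)
  ultimately show ?thesis by (simp add: zero_less_mult_iff)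
qed

text \<open>This is the one instance of homogeneity of the polar that is required. Dividing the
  bound for \<open>a\<close> by its polar value gives one inequality; scaling a bound for the
  normalised vector back to \<open>a\<close> gives the other.\<close>

lemma polar_fun_normalize:
  assumes "gauge_fun \<gamma>" and "a \<noteq> 0"
  shows "polar_fun \<gamma> (inverse (polar_fun \<gamma> a) *\<^sub>R a) = 1"
proof (rule antisym)
  let ?p = "polar_fun \<gamma> a" and ?b = "inverse (polar_fun \<gamma> a) *\<^sub>R a"
  have p: "0 < ?p" using polar_fun_pos[OF assms] .
  show "polar_fun \<gamma> ?b \<le> 1"
    using p inner_le_polar_fun[OF assms(1), of a]
    by (intro polar_fun_le) (simp_all add: field_simps)
  have q: "0 < polar_fun \<gamma> ?b" using p assms by (intro polar_fun_pos) auto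
  have "a \<bullet> z \<le> (?p * polar_fun \<gamma> ?b) * \<gamma> z" for z
    using p inner_le_polar_fun[OF assms(1), of ?b z] by (simp add: field_simps)
  then have "?p \<le> ?p * polar_fun \<gamma> ?b" using p q by (intro polar_fun_le) auto
  then show "1 \<le> polar_fun \<gamma> ?b" using p by simp
qed

text \<open>Rescaling \<open>z\<close> to gauge value \<open>s < t\<close> places it in the strict
  sublevel set, so the half-space bound becomes
  \<open>a \<bullet> z * s \<le> b * \<gamma> z\<close>. Hence \<open>b / s\<close> bounds the polar
  value of \<open>a\<close>, and \<open>s\<close> may tend to \<open>t\<close>.\<close>

lemma polar_fun_normalize_ge:
  assumes "gauge_fun \<gamma>" and "a \<noteq> 0" and "0 < t" and le: "\<And>z. \<gamma> z < t \<Longrightarrow> a \<bullet> z \<le> b"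
  shows "t \<le> inverse (polar_fun \<gamma> a) * b"
proof -
  have p: "0 < polar_fun \<gamma> a" using polar_fun_pos assms(1,2) by blast
  have bound: "a \<bullet> z * s \<le> b * \<gamma> z" if "0 < s" "s < t" for z s
  proof (cases "z = 0")
    case True
    then show ?thesis using gauge_fun_zero[OF assms(1)] by simp
  next
    case False
    then have pos: "0 < \<gamma> z" by (simp add: gauge_fun_pos_iff[OF assms(1)])
    then have "\<gamma> ((s / \<gamma> z) *\<^sub>R z) < t" using that by (simp add: gauge_fun_scale[OF assms(1)])
    from le[OF this] pos show ?thesis by (simp add: field_simps)
  qed
  \<comment> \<open>Only positive numbers compete in the infimum defining the polar. Testing with
    \<open>z = a\<close> and \<open>s = t / 2\<close>, one of the admissible levels, gives
    positivity of \<open>b\<close>.\<close>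
  have b: "0 < b"
  proof -
    have "0 < a \<bullet> a * (t / 2)" using assms(2,3) by simp
    also have "\<dots> \<le> b * \<gamma> a" using assms(3) by (intro bound) auto
    finally show ?thesis
      using assms(2) gauge_fun_pos_iff[OF assms(1), of a] by (simp add: zero_less_mult_iff)
  qed
  have "t * polar_fun \<gamma> a \<le> b"
  proof (rule field_le_mult_one_interval)
    fix r :: real assume r: "0 < r" "r < 1"
    have "polar_fun \<gamma> a \<le> b / (r * t)"
      using bound[of "r * t"] r b assms(3)
      by (intro polar_fun_le) (simp_all add: field_simps)
    then show "r * (t * polar_fun \<gamma> a) \<le> b" using r assms(3) by (simp add: field_simps)
  qed
  then show ?thesis using p by (simp add: field_simps)
qed

section \<open>Approximate orthogonality and best approximation on a line\<close>

lemma eps_birkhoff_line_iff: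
  "eps_birkhoff \<gamma> \<epsilon> (\<alpha> *\<^sub>R x + y) x \<longleftrightarrow> (\<forall>\<beta>. \<gamma> (\<alpha> *\<^sub>R x + y) \<le> \<gamma> (\<beta> *\<^sub>R x + y) + \<epsilon>)"
proof -
  have "\<alpha> *\<^sub>R x + y + l *\<^sub>R x = (\<alpha> + l) *\<^sub>R x + y" for l by (simp add: algebra_simps)
  then have "eps_birkhoff \<gamma> \<epsilon> (\<alpha> *\<^sub>R x + y) x \<longleftrightarrow>
      (\<forall>l. \<gamma> (\<alpha> *\<^sub>R x + y) \<le> \<gamma> ((\<alpha> + l) *\<^sub>R x + y) + \<epsilon>)"
    by (simp only: eps_birkhoff_def)
  also have "\<dots> \<longleftrightarrow> (\<forall>\<beta>. \<gamma> (\<alpha> *\<^sub>R x + y) \<le> \<gamma> (\<beta> *\<^sub>R x + y) + \<epsilon>)"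
    by (metis add.commute diff_add_cancel)
  finally show ?thesis .
qed

lemma eps_best_approx_translate:
  "eps_best_approx \<gamma> \<epsilon> ((+) y ` K) 0 (p + y) \<longleftrightarrow> eps_best_approx \<gamma> \<epsilon> K (- y) p"
  by (auto simp: eps_best_approx_def add.commute)

lemma eps_best_approx_span_iff:
  "eps_best_approx \<gamma> \<epsilon> (span {x}) (- y) (\<alpha> *\<^sub>R x) \<longleftrightarrow> eps_birkhoff \<gamma> \<epsilon> (\<alpha> *\<^sub>R x + y) x"
  unfolding eps_birkhoff_line_iff by (auto simp: eps_best_approx_def span_singleton)

text \<open>The functional \<open>xs\<close> is constant on the line and, having polar value 1, is
  dominated by \<open>\<gamma>\<close>. So \<open>xs \<bullet> y\<close> is a lower bound of
  \<open>\<gamma>\<close> on the line.\<close>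

lemma eps_birkhoff_if_polar:
  assumes "gauge_fun \<gamma>" and "polar_fun \<gamma> xs = 1" "xs \<bullet> x = 0" "\<gamma> (\<alpha> *\<^sub>R x + y) - \<epsilon> \<le> xs \<bullet> y"
  shows "eps_birkhoff \<gamma> \<epsilon> (\<alpha> *\<^sub>R x + y) x"
  unfolding eps_birkhoff_line_iff
proof
  fix \<beta>
  have "xs \<bullet> y = xs \<bullet> (\<beta> *\<^sub>R x + y)" using assms(3) by (simp add: inner_add_right)
  also have "\<dots> \<le> \<gamma> (\<beta> *\<^sub>R x + y)" using inner_le_polar_fun[OF assms(1), of xs] assms(2) by simp
  finally show "\<gamma> (\<alpha> *\<^sub>R x + y) \<le> \<gamma> (\<beta> *\<^sub>R x + y) + \<epsilon>" using assms(4) by simp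
qed

section \<open>Existence of the polar functional\<close>

lemma supporting_functional_of_line:
  fixes \<gamma> :: "real^'n \<Rightarrow> real"
  assumes "gauge_fun \<gamma>" and "0 < t" and line: "\<And>\<beta>. t \<le> \<gamma> (\<beta> *\<^sub>R x + y)"
  obtains xs where "polar_fun \<gamma> xs = 1" "xs \<bullet> x = 0" "t \<le> xs \<bullet> y"
proof -
  let ?B = "{z. \<gamma> z < t}" and ?L = "range (\<lambda>\<beta>. \<beta> *\<^sub>R x + y)"
  have "convex ?B" by (rule convex_strict_sublevel[OF convex_on_gauge_fun[OF assms(1)]])
  moreover have "convex ?L"
  proof -
    have "?L = (+) y ` span {x}" by (auto simp: span_singleton image_image add.commute)
    then show ?thesis by (simp add: subspace_imp_convex convex_translation)
  qed
  moreover have "0 \<in> ?B" using gauge_fun_zero[OF assms(1)] assms(2) by simp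
  moreover have "?B \<inter> ?L = {}" using line by (auto simp flip: not_le)
  ultimately obtain a b where a: "a \<noteq> 0"
    and B: "\<And>z. \<gamma> z < t \<Longrightarrow> a \<bullet> z \<le> b" and L: "\<And>\<beta>. b \<le> a \<bullet> (\<beta> *\<^sub>R x + y)"
    using separating_hyperplane_sets[of ?B ?L] by blast
  have ax: "a \<bullet> x = 0"
  proof (rule ccontr)
    assume "a \<bullet> x \<noteq> 0"
    \<comment> \<open>An affine function of \<open>\<beta>\<close> with non-zero slope is unbounded
      below: at this \<open>\<beta>\<close> its value is \<open>b - 1\<close>, against the lower
      bound \<open>b\<close>.\<close>
    then show False
      using L[of "(b - 1 - a \<bullet> y) / (a \<bullet> x)"] by (simp add: inner_add_right)
  qed
  let ?xs = "inverse (polar_fun \<gamma> a) *\<^sub>R a"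
  have "t \<le> inverse (polar_fun \<gamma> a) * b" using polar_fun_normalize_ge[OF assms(1) a assms(2) B] .
  also have "\<dots> \<le> ?xs \<bullet> y"
    using L[of 0] polar_fun_pos[OF assms(1) a] by (simp add: mult_left_mono)
  finally show ?thesis
    using that[of ?xs] polar_fun_normalize[OF assms(1) a] ax by simp
qed

text \<open>In dimension 1 with \<open>x \<noteq> 0\<close>, only the zero functional vanishes at
  \<open>x\<close>, and its polar value is 0. The implication then fails whenever
  \<open>\<alpha> *\<^sub>R x + y = 0\<close>, which explains the condition on the
  dimension.\<close>

lemma polar_functional_if_eps_birkhoff:
  fixes \<gamma> :: "real^'n \<Rightarrow> real"
  assumes "gauge_fun \<gamma>" and "CARD('n) \<ge> 2 \<or> x = 0" and "eps_birkhoff \<gamma> \<epsilon> (\<alpha> *\<^sub>R x + y) x"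
  shows "\<exists>xs. polar_fun \<gamma> xs = 1 \<and> xs \<bullet> x = 0 \<and> xs \<bullet> y \<ge> \<gamma> (\<alpha> *\<^sub>R x + y) - \<epsilon>"
proof (cases "0 < \<gamma> (\<alpha> *\<^sub>R x + y) - \<epsilon>")
  case True
  have "\<gamma> (\<alpha> *\<^sub>R x + y) - \<epsilon> \<le> \<gamma> (\<beta> *\<^sub>R x + y)" for \<beta>
    using assms(3) unfolding eps_birkhoff_line_iff by (simp add: algebra_simps)
  from supporting_functional_of_line[OF assms(1) True this] show ?thesis by blast
next
  case False
  obtain w where w: "w \<noteq> 0" "w \<bullet> x = 0"
  proof (cases "x = 0")
    case True
    \<comment> \<open>Every vector is orthogonal to 0, so an arbitrary coordinate vector
      serves.\<close>
    then show ?thesis using that[of "axis undefined 1"] by (simp add: axis_eq_0_iff)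
  next
    case False
    then show ?thesis
      using that orthogonal_to_vector_exists[of x] assms(2)
      by (auto simp: orthogonal_def inner_commute)
  qed
  define v where "v = (if 0 \<le> w \<bullet> y then w else - w)"
  have v: "v \<noteq> 0" "v \<bullet> x = 0" "0 \<le> v \<bullet> y" using w by (auto simp: v_def)
  show ?thesis
  proof (intro exI conjI)
    show "polar_fun \<gamma> (inverse (polar_fun \<gamma> v) *\<^sub>R v) = 1"
      by (rule polar_fun_normalize[OF assms(1) v(1)])
    have "0 \<le> (inverse (polar_fun \<gamma> v) *\<^sub>R v) \<bullet> y"
      using v(3) polar_fun_pos[OF assms(1) v(1)] by simp
    then show "\<gamma> (\<alpha> *\<^sub>R x + y) - \<epsilon> \<le> (inverse (polar_fun \<gamma> v) *\<^sub>R v) \<bullet> y" using False by simp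
  qed (simp add: v)
qed

section \<open>The compact interval of admissible coefficients\<close>

lemma eps_birkhoff_set_interval:
  fixes \<gamma> :: "real^'n \<Rightarrow> real"
  assumes "gauge_fun \<gamma>" and "\<epsilon> \<ge> 0" and "x \<noteq> 0"
  shows "\<exists>a b. a \<le> b \<and> {\<beta>. eps_birkhoff \<gamma> \<epsilon> (\<beta> *\<^sub>R x + y) x} = {a..b}"
proof -
  define f where "f = (\<lambda>\<beta>. \<gamma> (\<beta> *\<^sub>R x + y))"
  define S where "S = {\<beta>. \<forall>t. f \<beta> \<le> f t + \<epsilon>}"
  have cont: "continuous_on UNIV f"
    unfolding f_def
    by (intro continuous_on_compose2[OF continuous_on_gauge_fun[OF assms(1)]] continuous_intros) auto
  have conv: "convex_on UNIV f"
  proof (rule convex_onI)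
    fix t u v :: real
    assume "0 < t" "t < 1"
    moreover have "((1 - t) *\<^sub>R u + t *\<^sub>R v) *\<^sub>R x + y = (1 - t) *\<^sub>R (u *\<^sub>R x + y) + t *\<^sub>R (v *\<^sub>R x + y)"
      by (simp add: algebra_simps)
    ultimately show "f ((1 - t) *\<^sub>R u + t *\<^sub>R v) \<le> (1 - t) * f u + t * f v"
      unfolding f_def using convex_onD[OF convex_on_gauge_fun[OF assms(1)], of t "u *\<^sub>R x + y" "v *\<^sub>R x + y"]
      by simp
  qed simp
  obtain c where c: "0 < c" "\<And>z. c * norm z \<le> \<gamma> z"
    using gauge_fun_lower_bound[OF assms(1)] by blast
  have compact_sublevel: "compact {\<beta>. f \<beta> \<le> r}" for r
  proof -
    \<comment> \<open>Coercivity: the gauge controls the norm of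
      \<open>\<beta> *\<^sub>R x + y\<close>, and since \<open>x \<noteq> 0\<close> the triangle
      inequality turns this into a bound on \<open>\<beta>\<close>.\<close>
    have "\<bar>\<beta>\<bar> \<le> (r / c + norm y) / norm x" if "f \<beta> \<le> r" for \<beta>
    proof -
      have "c * norm (\<beta> *\<^sub>R x + y) \<le> r" using c(2) that unfolding f_def by (rule order_trans)
      then have "norm (\<beta> *\<^sub>R x + y) \<le> r / c" using c(1) by (simp add: field_simps)
      moreover have "norm (\<beta> *\<^sub>R x) \<le> norm (\<beta> *\<^sub>R x + y) + norm y"
        using norm_triangle_ineq4[of "\<beta> *\<^sub>R x + y" y] by simp
      ultimately show ?thesis using assms(3) by (simp add: field_simps)
    qed
    then have "bounded {\<beta>. f \<beta> \<le> r}" by (auto simp: bounded_real)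
    moreover have "closed {\<beta>. f \<beta> \<le> r}" by (intro closed_Collect_le cont continuous_on_const)
    ultimately show ?thesis by (simp add: compact_eq_bounded_closed)
  qed
  \<comment> \<open>As an intersection of compact convex sublevel sets of \<open>f\<close>,
    \<open>S\<close> inherits both properties.\<close>
  have S_eq: "S = (\<Inter>t. {\<beta>. f \<beta> \<le> f t + \<epsilon>})" by (auto simp: S_def)
  have "compact S"
    unfolding S_eq using compact_sublevel by (intro compact_Inter) auto
  moreover have "connected S"
    unfolding S_eq using convex_sublevel[OF conv] by (intro convex_connected convex_INT) auto
  ultimately obtain a b where ab: "S = {a..b}"
    using connected_compact_interval_1[of S] by auto
  \<comment> \<open>So far \<open>{a..b}\<close> could be empty. A minimiser of \<open>f\<close> on
    the compact sublevel set at height \<open>f 0\<close>, which contains 0, is a global minimiser;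
    it lies in \<open>S\<close> because \<open>\<epsilon> \<ge> 0\<close>.\<close>
  obtain m where m: "\<And>t. f t \<le> f 0 \<Longrightarrow> f m \<le> f t" "f m \<le> f 0"
    using continuous_attains_inf[OF compact_sublevel[of "f 0"] _ continuous_on_subset[OF cont]] by auto
  have "f m \<le> f t" for t using m(1)[of t] m(2) by linarith
  then have "m \<in> S" using assms(2) unfolding S_def by (simp add: add_increasing2)
  with ab have "a \<le> b" by auto
  moreover have "{\<beta>. eps_birkhoff \<gamma> \<epsilon> (\<beta> *\<^sub>R x + y) x} = S"
    by (simp add: S_def f_def eps_birkhoff_line_iff)
  ultimately show ?thesis using ab by blast
qed

theorem corollary3p17:
  fixes \<gamma> :: "real^'n \<Rightarrow> real" and x y :: "real^'n" and \<epsilon> \<alpha> :: real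
  assumes "gauge_fun \<gamma>" and "\<epsilon> \<ge> 0"
  shows
    "(eps_best_approx \<gamma> \<epsilon> ((+) y ` span {x}) 0 (\<alpha> *\<^sub>R x + y) \<longleftrightarrow>
        eps_best_approx \<gamma> \<epsilon> (span {x}) (- y) (\<alpha> *\<^sub>R x)) \<and>
     (eps_best_approx \<gamma> \<epsilon> (span {x}) (- y) (\<alpha> *\<^sub>R x) \<longleftrightarrow>
        eps_birkhoff \<gamma> \<epsilon> (\<alpha> *\<^sub>R x + y) x) \<and>
     ((\<exists>xs. polar_fun \<gamma> xs = 1 \<and> xs \<bullet> x = 0 \<and> xs \<bullet> y \<ge> \<gamma> (\<alpha> *\<^sub>R x + y) - \<epsilon>) \<longrightarrow>
        eps_birkhoff \<gamma> \<epsilon> (\<alpha> *\<^sub>R x + y) x) \<and>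
     (CARD('n) \<ge> 2 \<or> x = 0 \<longrightarrow> eps_birkhoff \<gamma> \<epsilon> (\<alpha> *\<^sub>R x + y) x \<longrightarrow>
        (\<exists>xs. polar_fun \<gamma> xs = 1 \<and> xs \<bullet> x = 0 \<and> xs \<bullet> y \<ge> \<gamma> (\<alpha> *\<^sub>R x + y) - \<epsilon>)) \<and>
     (x \<noteq> 0 \<longrightarrow> (\<exists>a b. a \<le> b \<and> {\<beta>. eps_birkhoff \<gamma> \<epsilon> (\<beta> *\<^sub>R x + y) x} = {a..b}))"
  by (intro conjI impI eps_best_approx_translate eps_best_approx_span_iff
      eps_birkhoff_set_interval polar_functional_if_eps_birkhoff assms)
    (auto intro: eps_birkhoff_if_polar[OF assms(1)])

end
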